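(* Every finite-dimensional semisimple $\omega$-Lie algebra over $K$ is either a Lie algebra, or has dimension $\le 4$.
   Context: $K$ is a field of characteristic different from $2$ and $3$. An $\omega$-Lie algebra is an anticommutative algebra $L$ over $K$ with multiplication $[\cdot,\cdot]$ together with a bilinear form $\omega: L\times L\to K$ (necessarily skew-symmetric) such that for all $x,y,z\in L$ $$[[x,y],z]+[[z,x],y]+[[y,z],x] = \omega(x,y)z+\omega(z,x)y+\omega(y,z)x .$$ It is a Lie algebra if its bracket satisfies the Jacobi identity. Lie-algebraic notions not involving $\omega$ are extended verbatim to $\omega$-Lie algebras; in particular, an ideal is a subspace $I$ with $[I,L]\subseteq I$, and $L$ is semisimple if it has no nonzero solvable ideals. *)

theory Defs
  imports Complex_Main
begin

locale anticomm_algebra = vector_space scale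
  for scale :: "'k::field \<Rightarrow> 'v::ab_group_add \<Rightarrow> 'v" (infixr "*s" 75) +
  fixes bracket :: "'v \<Rightarrow> 'v \<Rightarrow> 'v"
  assumes linear_bracket_left: "Vector_Spaces.linear scale scale (\<lambda>x. bracket x y)"
    and linear_bracket_right: "Vector_Spaces.linear scale scale (\<lambda>y. bracket x y)"
    and anticommute: "bracket x y = - bracket y x"
begin

definition ideal :: "'v set \<Rightarrow> bool" where
  "ideal I \<longleftrightarrow> subspace I \<and> (\<forall>x\<in>I. \<forall>y. bracket x y \<in> I)"

primrec derived_series :: "'v set \<Rightarrow> nat \<Rightarrow> 'v set" where
  "derived_series A 0 = A"
| "derived_series A (Suc n) =
     span {bracket x y | x y. x \<in> derived_series A n \<and> y \<in> derived_series A n}"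

definition solvable :: "'v set \<Rightarrow> bool" where
  "solvable A \<longleftrightarrow> (\<exists>n. derived_series A n = {0})"

definition semisimple :: bool where
  "semisimple \<longleftrightarrow> (\<forall>I. ideal I \<and> solvable I \<longrightarrow> I = {0})"

end

locale lie_algebra = anticomm_algebra +
  assumes jacobi:
    "bracket (bracket x y) z + bracket (bracket z x) y + bracket (bracket y z) x = 0"

text \<open>Skew-symmetry of the form is not assumed: over a field of characteristic other than 2 and 3
  it follows from the identity below.\<close>

locale omega_lie_algebra = anticomm_algebra scale bracket
  for scale :: "'k::field \<Rightarrow> 'v::ab_group_add \<Rightarrow> 'v" (infixr "*s" 75)
    and bracket :: "'v \<Rightarrow> 'v \<Rightarrow> 'v" +
  fixes omega :: "'v \<Rightarrow> 'v \<Rightarrow> 'k"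
  assumes linear_omega_left: "Vector_Spaces.linear scale (*) (\<lambda>x. omega x y)"
    and linear_omega_right: "Vector_Spaces.linear scale (*) (\<lambda>y. omega x y)"
    and omega_jacobi:
      "bracket (bracket x y) z + bracket (bracket z x) y + bracket (bracket y z) x
       = omega x y *s z + omega z x *s y + omega y z *s x"

end

theory Submission
  imports Defs
begin

text \<open>The proof rests on one identity. In every anticommutative algebra the Jacobians satisfy a relation
in degree four (\<open>jacobian_relation\<close>). Inserting the defining identity of an \<open>\<omega>\<close>-Lie algebra
turns it into \<open>\<omega> \<and> [\<cdot>,\<cdot>] = d\<omega> \<and> id\<close> (\<open>omega_wedge_bracket\<close>). If \<open>\<omega>(x,y) = 1\<close> and \<open>a\<close>, \<open>b\<close> are
orthogonal to \<open>x\<close> and \<open>y\<close>, this determines \<open>[a,b] + \<omega>(a,b)[x,y]\<close> as a combination of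
\<open>a, b, x, y\<close>. The identity is the stronger the larger the rank of \<open>\<omega>\<close> is, and the proof
distinguishes this rank.

\<^item> Rank 0: the bracket satisfies the Jacobi identity.

\<^item> Rank at least 6: three mutually orthogonal hyperbolic pairs force so many brackets to vanish
  that the \<open>\<omega>\<close>-Jacobi identity fails (\<open>no_three_hyperbolic_pairs\<close>).

\<^item> Rank 4: the kernel of \<open>\<omega>\<close> is an abelian ideal, hence zero, and the algebra is spanned by two
  hyperbolic pairs (\<open>dim_le_4_two_pairs\<close>).

\<^item> Rank 2: the kernel \<open>K\<close> of \<open>\<omega>\<close> has codimension 2, and the identity shows
  \<open>[x,y] = f(x) y - f(y) x\<close> on \<open>K\<close>, where \<open>f(x)\<close> is the trace of \<open>x\<close> on the plane \<open>L/K\<close>. It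
  remains to show that \<open>K\<close> has dimension at most 2 if \<open>L\<close> is semisimple. Commuting traceless
  \<open>2 \<times> 2\<close> matrices are proportional, which leaves few possibilities for the action of \<open>K\<close> on
  \<open>L/K\<close>. If its image is contained in a line \<open>\<langle>z\<rangle>\<close>, then either \<open>K + \<langle>z\<rangle>\<close> is a solvable ideal, or
  the elements of \<open>K\<close> that act as zero form an abelian ideal of codimension at most 1 in \<open>K\<close>
  (\<open>triangular_kernel_small\<close>). Otherwise the elements that act as zero form an abelian ideal of
  codimension at most 1 in \<open>K\<close>, unless \<open>K\<close> is two-dimensional (\<open>traceless_kernel_small\<close>,
  \<open>traceless_part_trivial_kernel_small\<close>).

All the ideals that occur are abelian or metabelian, so the only consequence of semisimplicity that
enters is \<open>semisimple_metabelian_ideal\<close>.\<close>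


section \<open>Anticommutative algebras\<close>

context anticomm_algebra
begin

lemma bracket_bilinear:
  "bracket (x + y) z = bracket x z + bracket y z"
  "bracket x (y + z) = bracket x y + bracket x z"
  "bracket (x - y) z = bracket x z - bracket y z"
  "bracket x (y - z) = bracket x y - bracket x z"
  "bracket (- x) z = - bracket x z"
  "bracket x (- z) = - bracket x z"
  "bracket (c *s x) z = c *s bracket x z"
  "bracket x (c *s z) = c *s bracket x z"
  "bracket 0 z = 0"
  "bracket x 0 = 0"
proof -
  interpret l: Vector_Spaces.linear scale scale "\<lambda>x. bracket x z" for z
    by (rule linear_bracket_left)
  interpret r: Vector_Spaces.linear scale scale "\<lambda>z. bracket x z" for x
    by (rule linear_bracket_right)
  show "bracket (x + y) z = bracket x z + bracket y z"
    "bracket x (y + z) = bracket x y + bracket x z"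
    "bracket (x - y) z = bracket x z - bracket y z"
    "bracket x (y - z) = bracket x y - bracket x z"
    "bracket (- x) z = - bracket x z"
    "bracket x (- z) = - bracket x z"
    "bracket (c *s x) z = c *s bracket x z"
    "bracket x (c *s z) = c *s bracket x z"
    "bracket 0 z = 0"
    "bracket x 0 = 0"
    by (fact l.add r.add l.diff r.diff l.neg r.neg l.scale r.scale l.zero r.zero)+
qed

definition jacobian :: "'v \<Rightarrow> 'v \<Rightarrow> 'v \<Rightarrow> 'v" where
  "jacobian x y z = bracket (bracket x y) z + bracket (bracket z x) y + bracket (bracket y z) x"

text \<open>Expanding the Jacobians gives products of the shapes \<open>((ab)c)d\<close> and \<open>(ab)(cd)\<close>. Both sides contain
each of the twelve products of the first shape once, with the sign of the permutation. On the left
the products of the second shape cancel, because exchanging the pairs \<open>ab\<close> and \<open>cd\<close> is an even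
permutation while \<open>(ab)(cd) = -(cd)(ab)\<close>.\<close>

lemma jacobian_relation:
  "jacobian (bracket x y) z t + jacobian (bracket z t) x y
     - jacobian (bracket x z) y t - jacobian (bracket y t) x z
     + jacobian (bracket x t) y z + jacobian (bracket y z) x t
   = bracket (jacobian x y z) t - bracket (jacobian x y t) z
     + bracket (jacobian x z t) y - bracket (jacobian y z t) x"
proof -
  have swaps: "bracket z x = - bracket x z" "bracket y x = - bracket x y"
      "bracket t x = - bracket x t" "bracket z y = - bracket y z"
      "bracket t y = - bracket y t" "bracket t z = - bracket z t"
    by (simp_all only: anticommute[of z x] anticommute[of y x] anticommute[of t x]
        anticommute[of z y] anticommute[of t y] anticommute[of t z])
  have left: "bracket w (bracket u v) = - bracket (bracket u v) w" if "w \<in> {x, y, z, t}" for u v w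
    by (rule anticommute)
  have products: "bracket (bracket z t) (bracket x y) = - bracket (bracket x y) (bracket z t)"
      "bracket (bracket y t) (bracket x z) = - bracket (bracket x z) (bracket y t)"
      "bracket (bracket y z) (bracket x t) = - bracket (bracket x t) (bracket y z)"
    by (rule anticommute)+
  show ?thesis
    unfolding jacobian_def bracket_bilinear
    by (simp add: swaps left products bracket_bilinear)
qed

lemma bracket_span_eq_0:
  assumes "\<And>a b. a \<in> S \<Longrightarrow> b \<in> S \<Longrightarrow> bracket a b = 0"
    and "x \<in> span S" and "y \<in> span S"
  shows "bracket x y = 0"
proof -
  have "subspace {y. bracket a y = 0}" "subspace {x. bracket x a = 0}" for a
    by (simp_all add: subspace_def bracket_bilinear)
  hence "bracket a y = 0" if "a \<in> S" for a
    using span_minimal[of S "{y. bracket a y = 0}"] assms(1,3) that by blast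
  thus ?thesis
    using span_minimal[of S "{x. bracket x y = 0}"] \<open>\<And>a. subspace {x. bracket x a = 0}\<close> assms(2)
    by blast
qed

lemma semisimple_metabelian_ideal:
  assumes "semisimple" and "ideal I"
    and comm: "\<And>a b c d. a \<in> I \<Longrightarrow> b \<in> I \<Longrightarrow> c \<in> I \<Longrightarrow> d \<in> I \<Longrightarrow>
      bracket (bracket a b) (bracket c d) = 0"
  shows "I = {0}"
proof -
  let ?S = "{bracket x y | x y. x \<in> I \<and> y \<in> I}"
  have "bracket x y = 0" if "x \<in> span ?S" "y \<in> span ?S" for x y
    by (rule bracket_span_eq_0[OF _ that]) (use comm in blast)
  hence "{bracket x y | x y. x \<in> span ?S \<and> y \<in> span ?S} \<subseteq> {0}"
    by blast
  hence "span {bracket x y | x y. x \<in> span ?S \<and> y \<in> span ?S} \<subseteq> {0}"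
    by (rule span_minimal) simp
  hence "derived_series I (Suc (Suc 0)) = {0}"
    using span_zero by fastforce
  thus ?thesis
    using assms(1,2) unfolding semisimple_def solvable_def by blast
qed

end

section \<open>The form and the bracket\<close>

locale omega_lie_algebra_char_not_2_3 = omega_lie_algebra scale bracket omega
  for scale :: "'k::field \<Rightarrow> 'v::ab_group_add \<Rightarrow> 'v" (infixr "*s" 75)
    and bracket :: "'v \<Rightarrow> 'v \<Rightarrow> 'v"
    and omega :: "'v \<Rightarrow> 'v \<Rightarrow> 'k" +
  assumes two_nonzero: "(2::'k) \<noteq> 0"
    and three_nonzero: "(3::'k) \<noteq> 0"
begin

lemma omega_bilinear:
  "omega (x + y) z = omega x z + omega y z"
  "omega x (y + z) = omega x y + omega x z"
  "omega (x - y) z = omega x z - omega y z"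
  "omega x (y - z) = omega x y - omega x z"
  "omega (- x) z = - omega x z"
  "omega x (- z) = - omega x z"
  "omega (c *s x) z = c * omega x z"
  "omega x (c *s z) = c * omega x z"
  "omega 0 z = 0"
  "omega x 0 = 0"
proof -
  interpret l: Vector_Spaces.linear scale "(*)" "\<lambda>x. omega x z" for z
    by (rule linear_omega_left)
  interpret r: Vector_Spaces.linear scale "(*)" "\<lambda>z. omega x z" for x
    by (rule linear_omega_right)
  show "omega (x + y) z = omega x z + omega y z"
    "omega x (y + z) = omega x y + omega x z"
    "omega (x - y) z = omega x z - omega y z"
    "omega x (y - z) = omega x y - omega x z"
    "omega (- x) z = - omega x z"
    "omega x (- z) = - omega x z"
    "omega (c *s x) z = c * omega x z"
    "omega x (c *s z) = c * omega x z"
    "omega 0 z = 0"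
    "omega x 0 = 0"
    by (fact l.add r.add l.diff r.diff l.neg r.neg l.scale r.scale l.zero r.zero)+
qed

lemma double_eq_0_scalar: "a + a = (0::'k) \<longleftrightarrow> a = 0"
  using two_nonzero by (metis mult_2 mult_eq_0_iff)

lemma eq_minus_self_scalar: "a = - (a::'k) \<longleftrightarrow> a = 0"
  using double_eq_0_scalar[of a] by (metis add.right_inverse add.inverse_neutral)

lemma double_eq_0_vector: "v + v = (0::'v) \<longleftrightarrow> v = 0"
  using two_nonzero by (metis scale_eq_0_iff scale_left_distrib scale_one one_add_one)

lemma bracket_self: "bracket x x = 0"
  by (metis anticommute double_eq_0_vector add.right_inverse)

text \<open>The defining identity at \<open>x, x, x\<close> reads \<open>0 = 3 \<omega>(x,x) x\<close>.\<close>

lemma omega_self: "omega x x = 0"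
proof (cases "x = 0")
  case False
  have "(3 * omega x x) *s x = omega x x *s x + omega x x *s x + omega x x *s x"
    by (simp flip: scale_left_distrib)
  also have "\<dots> = 0"
    using omega_jacobi[of x x x] by (simp add: bracket_self bracket_bilinear)
  finally show ?thesis
    using False three_nonzero by simp
qed (simp add: omega_bilinear)

lemma omega_skew: "omega x y = - omega y x"
proof -
  have "omega x y + omega y x = omega (x + y) (x + y)"
    by (simp only: omega_bilinear) (simp add: omega_self add.commute)
  thus ?thesis by (simp only: omega_self eq_neg_iff_add_eq_0)
qed

text \<open>Up to sign, this is the Chevalley-Eilenberg differential of \<open>\<omega>\<close>.\<close>

definition d_omega :: "'v \<Rightarrow> 'v \<Rightarrow> 'v \<Rightarrow> 'k" where
  "d_omega x y z = omega (bracket x y) z + omega (bracket z x) y + omega (bracket y z) x"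

text \<open>The equation \<open>\<omega> \<and> [\<cdot>,\<cdot>] = d\<omega> \<and> id\<close>, evaluated at \<open>x, y, z, t\<close>. In \<open>jacobian_relation\<close> the
defining identity contributes \<open>\<omega> \<and> [\<cdot>,\<cdot>] + d\<omega> \<and> id\<close> on the left, and on the right, where each
product \<open>\<omega>(a,b)[c,d]\<close> arises from two Jacobians, \<open>2 \<omega> \<and> [\<cdot>,\<cdot>]\<close>.\<close>

lemma omega_wedge_bracket:
  "omega x y *s bracket z t + omega z t *s bracket x y
     - omega x z *s bracket y t - omega y t *s bracket x z
     + omega x t *s bracket y z + omega y z *s bracket x t
   = d_omega x y z *s t - d_omega x y t *s z + d_omega x z t *s y - d_omega y z t *s x"
proof -
  have J: "jacobian x y z = omega x y *s z + omega z x *s y + omega y z *s x" for x y z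
    by (simp add: jacobian_def omega_jacobi)
  have swaps: "bracket z x = - bracket x z" "bracket y x = - bracket x y"
      "bracket t x = - bracket x t" "bracket z y = - bracket y z"
      "bracket t y = - bracket y t" "bracket t z = - bracket z t"
    by (simp_all only: anticommute[of z x] anticommute[of y x] anticommute[of t x]
        anticommute[of z y] anticommute[of t y] anticommute[of t z])
  have oswaps: "omega z x = - omega x z" "omega y x = - omega x y"
      "omega t x = - omega x t" "omega z y = - omega y z"
      "omega t y = - omega y t" "omega t z = - omega z t"
    by (rule omega_skew)+
  have left: "omega w (bracket u v) = - omega (bracket u v) w" for u v w
    by (rule omega_skew)
  show ?thesis
    using jacobian_relation[of x y z t]
    unfolding J d_omega_def
    by (simp add: bracket_bilinear omega_bilinear swaps oswaps left algebra_simps)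
qed

lemma d_omega_cyclic: "d_omega x y z = d_omega y z x"
  by (simp add: d_omega_def add.commute add.left_commute)

lemma wedge_at_hyperbolic_pair:
  assumes "omega x y = 1" and "omega x a = 0" "omega y a = 0" "omega x b = 0" "omega y b = 0"
  shows "bracket a b + omega a b *s bracket x y
    = d_omega x y a *s b - d_omega x y b *s a + d_omega x a b *s y - d_omega y a b *s x"
  using omega_wedge_bracket[of x y a b] assms by simp

section \<open>Forms of rank at least six\<close>

definition hyperbolic_pairs2 :: "'v \<Rightarrow> 'v \<Rightarrow> 'v \<Rightarrow> 'v \<Rightarrow> bool" where
  "hyperbolic_pairs2 x y z t \<longleftrightarrow> omega x y = 1 \<and> omega z t = 1 \<and>
     omega x z = 0 \<and> omega x t = 0 \<and> omega y z = 0 \<and> omega y t = 0"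

lemma hyperbolic_pairs2_values:
  assumes "hyperbolic_pairs2 x y z t"
  shows "omega x y = 1" "omega y x = - 1" "omega z t = 1" "omega t z = - 1"
    "omega x z = 0" "omega x t = 0" "omega y z = 0" "omega y t = 0"
    "omega z x = 0" "omega t x = 0" "omega z y = 0" "omega t y = 0"
  using assms omega_skew[of y x] omega_skew[of t z] omega_skew[of z x] omega_skew[of t x]
    omega_skew[of z y] omega_skew[of t y]
  by (simp_all add: hyperbolic_pairs2_def)

lemma hyperbolic_pairs2_symmetries:
  assumes "hyperbolic_pairs2 x y z t"
  shows "hyperbolic_pairs2 z t x y" "hyperbolic_pairs2 y (- x) z t"
  by (simp_all add: hyperbolic_pairs2_def omega_bilinear hyperbolic_pairs2_values[OF assms])

definition hyperbolic_pairs3 :: "'v \<Rightarrow> 'v \<Rightarrow> 'v \<Rightarrow> 'v \<Rightarrow> 'v \<Rightarrow> 'v \<Rightarrow> bool" where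
  "hyperbolic_pairs3 x1 y1 x2 y2 x3 y3 \<longleftrightarrow> hyperbolic_pairs2 x1 y1 x2 y2 \<and>
     hyperbolic_pairs2 x1 y1 x3 y3 \<and> hyperbolic_pairs2 x2 y2 x3 y3"

lemma hyperbolic_pairs3D:
  assumes "hyperbolic_pairs3 x1 y1 x2 y2 x3 y3"
  shows "hyperbolic_pairs2 x1 y1 x2 y2" "hyperbolic_pairs2 x1 y1 x3 y3"
    "hyperbolic_pairs2 x2 y2 x3 y3"
  using assms by (simp_all add: hyperbolic_pairs3_def)

lemmas hyperbolic_pairs3_values =
  hyperbolic_pairs3D(1)[THEN hyperbolic_pairs2_values(1)]
  hyperbolic_pairs3D[THEN hyperbolic_pairs2_values(2)]
  hyperbolic_pairs3D(3)[THEN hyperbolic_pairs2_values(1)]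
  hyperbolic_pairs3D[THEN hyperbolic_pairs2_values(3)]
  hyperbolic_pairs3D[THEN hyperbolic_pairs2_values(4)]
  hyperbolic_pairs3D[THEN hyperbolic_pairs2_values(5)]
  hyperbolic_pairs3D[THEN hyperbolic_pairs2_values(6)]
  hyperbolic_pairs3D[THEN hyperbolic_pairs2_values(7)]
  hyperbolic_pairs3D[THEN hyperbolic_pairs2_values(8)]
  hyperbolic_pairs3D[THEN hyperbolic_pairs2_values(9)]
  hyperbolic_pairs3D[THEN hyperbolic_pairs2_values(10)]
  hyperbolic_pairs3D[THEN hyperbolic_pairs2_values(11)]
  hyperbolic_pairs3D[THEN hyperbolic_pairs2_values(12)]

text \<open>The pairs may be permuted, and in each of them \<open>(x, y)\<close> may be replaced by \<open>(y, -x)\<close>. So a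
statement that involves only the first vector of a pair holds for the second one as well.\<close>

lemma hyperbolic_pairs3_symmetries:
  assumes "hyperbolic_pairs3 x1 y1 x2 y2 x3 y3"
  shows "hyperbolic_pairs3 x2 y2 x3 y3 x1 y1" "hyperbolic_pairs3 x3 y3 x1 y1 x2 y2"
    and "hyperbolic_pairs3 x2 y2 x1 y1 x3 y3" "hyperbolic_pairs3 x1 y1 x3 y3 x2 y2"
    and "hyperbolic_pairs3 y1 (- x1) x2 y2 x3 y3" "hyperbolic_pairs3 x1 y1 y2 (- x2) x3 y3"
      "hyperbolic_pairs3 x1 y1 x2 y2 y3 (- x3)"
  using assms hyperbolic_pairs2_symmetries unfolding hyperbolic_pairs3_def by blast+

text \<open>Each of the three cyclic variants of \<open>\<omega>([x1,x2],x3)\<close> equals \<open>-d\<omega>(x1,x2,x3)\<close>, by the wedge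
identity at one of the three pairs. Since \<open>d\<omega>(x1,x2,x3)\<close> is their sum, it equals \<open>-3\<close> times
itself, and 4 is invertible.\<close>

lemma omega_bracket_three_pairs_eq_0:
  assumes h: "hyperbolic_pairs3 x1 y1 x2 y2 x3 y3"
  shows "omega (bracket x1 x2) x3 = 0"
proof -
  have T: "omega (bracket x1 x2) x3 = - d_omega x1 x2 x3"
    if h: "hyperbolic_pairs3 x1 y1 x2 y2 x3 y3" for x1 y1 x2 y2 x3 y3
  proof -
    note o = hyperbolic_pairs3_values[OF h]
    have "bracket x1 x2 = d_omega x3 y3 x1 *s x2 - d_omega x3 y3 x2 *s x1
        + d_omega x3 x1 x2 *s y3 - d_omega y3 x1 x2 *s x3"
      using wedge_at_hyperbolic_pair[of x3 y3 x1 x2] o by simp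
    thus ?thesis
      by (simp add: omega_bilinear o omega_self d_omega_cyclic[of x3])
  qed
  let ?d = "d_omega x1 x2 x3"
  have "omega (bracket x1 x2) x3 = - ?d" "omega (bracket x2 x3) x1 = - ?d"
      "omega (bracket x3 x1) x2 = - ?d"
    using T[OF h] T[OF hyperbolic_pairs3_symmetries(1)[OF h]]
      T[OF hyperbolic_pairs3_symmetries(2)[OF h]]
    by (simp_all add: d_omega_cyclic[of x3] d_omega_cyclic[of x1 x2 x3, symmetric])
  moreover from this have "?d = - ?d - ?d - ?d"
    unfolding d_omega_def by simp
  hence "(2 * 2) * ?d = 0" by algebra
  hence "?d = 0" using two_nonzero by (simp only: mult_eq_0_iff simp_thms)
  ultimately show ?thesis by simp
qed

lemma bracket_across_pairs:
  assumes h: "hyperbolic_pairs3 x1 y1 x2 y2 x3 y3"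
  shows "bracket x1 x2 = d_omega x3 y3 x1 *s x2 - d_omega x3 y3 x2 *s x1"
proof -
  note o = hyperbolic_pairs3_values[OF h]
  have "bracket x1 x2 = d_omega x3 y3 x1 *s x2 - d_omega x3 y3 x2 *s x1
      + d_omega x3 x1 x2 *s y3 - d_omega y3 x1 x2 *s x3" (is "?l = ?r")
    using wedge_at_hyperbolic_pair[of x3 y3 x1 x2] o by simp
  moreover have "omega (bracket x1 x2) x3 = 0"
    using omega_bracket_three_pairs_eq_0[OF h] .
  moreover have "omega (bracket x1 x2) y3 = 0"
    by (rule omega_bracket_three_pairs_eq_0[OF hyperbolic_pairs3_symmetries(7)[OF h]])
  moreover have "omega ?r x3 = - d_omega x3 x1 x2" "omega ?r y3 = - d_omega y3 x1 x2"
    by (simp_all add: omega_bilinear o omega_self)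
  ultimately show ?thesis by simp
qed

text \<open>The wedge identity at any two of the three pairs gives \<open>[x1,y1] + [x2,y2]\<close> and its two analogues,
and these sums determine \<open>\<omega>([x2,y2],x1)\<close>. Together with the brackets across the pairs, this
expresses the left-hand value of \<open>d\<omega>\<close> through the right-hand one.\<close>

lemma d_omega_three_pairs_ratio:
  assumes h: "hyperbolic_pairs3 x1 y1 x2 y2 x3 y3"
  shows "3 * d_omega x2 y2 x1 = 5 * d_omega x3 y3 x1"
proof -
  note h' = hyperbolic_pairs3_symmetries(6)[OF h]
  note o = hyperbolic_pairs3_values[OF h]
  (* The sums of [xi,yi] and [xj,yj], paired with x1, for the three choices of two pairs. *)
  have pair: "omega (bracket x1 y1) x1 + omega (bracket x2 y2) x1 = - d_omega x2 y2 x1"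
      "omega (bracket x1 y1) x1 + omega (bracket x3 y3) x1 = - d_omega x3 y3 x1"
      "omega (bracket x2 y2) x1 + omega (bracket x3 y3) x1 = 0"
    using arg_cong[OF wedge_at_hyperbolic_pair[of x1 y1 x2 y2], of "\<lambda>v. omega v x1"]
      arg_cong[OF wedge_at_hyperbolic_pair[of x1 y1 x3 y3], of "\<lambda>v. omega v x1"]
      arg_cong[OF wedge_at_hyperbolic_pair[of x2 y2 x3 y3], of "\<lambda>v. omega v x1"]
    by (simp_all add: omega_bilinear o omega_self add.commute d_omega_cyclic[of x1 x2 y2]
        d_omega_cyclic[of x1 x3 y3])
  have "omega (bracket x1 x2) y2 = d_omega x3 y3 x1"
    using bracket_across_pairs[OF h] by (simp add: omega_bilinear o)
  moreover have "omega (bracket y2 x1) x2 = d_omega x3 y3 x1"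
    using bracket_across_pairs[OF h'] anticommute[of y2 x1] by (simp add: omega_bilinear o)
  ultimately have "d_omega x2 y2 x1 = omega (bracket x2 y2) x1 + 2 * d_omega x3 y3 x1"
    unfolding d_omega_def[of x2 y2 x1] by simp
  with pair show ?thesis by algebra
qed

text \<open>The ratio just found can also be read with the second and third pair exchanged, and \<open>9 \<noteq> 25\<close>
because 16 is invertible. So the values of \<open>d\<omega>\<close> vanish, hence so do the brackets across the pairs
and the brackets \<open>[xi,yi]\<close>. This leaves \<open>0 = \<omega>(x1,y1) x2\<close> in the \<open>\<omega>\<close>-Jacobi identity.\<close>

lemma no_three_hyperbolic_pairs: "\<not> hyperbolic_pairs3 x1 y1 x2 y2 x3 y3"
proof
  assume h: "hyperbolic_pairs3 x1 y1 x2 y2 x3 y3"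
  have d0: "d_omega x2 y2 x1 = 0" if h: "hyperbolic_pairs3 x1 y1 x2 y2 x3 y3" for x1 y1 x2 y2 x3 y3
  proof -
    have "hyperbolic_pairs3 x1 y1 x3 y3 x2 y2"
      using h hyperbolic_pairs3_symmetries by blast
    from d_omega_three_pairs_ratio[OF h] d_omega_three_pairs_ratio[OF this]
    have "(2 * 2 * 2 * 2) * d_omega x2 y2 x1 = 0" by algebra
    thus ?thesis using two_nonzero by (simp only: mult_eq_0_iff simp_thms)
  qed
  have across: "bracket x1 x2 = 0" if h: "hyperbolic_pairs3 x1 y1 x2 y2 x3 y3" for x1 y1 x2 y2 x3 y3
  proof -
    have "hyperbolic_pairs3 x1 y1 x3 y3 x2 y2" "hyperbolic_pairs3 x2 y2 x3 y3 x1 y1"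
      using h hyperbolic_pairs3_symmetries by blast+
    from this[THEN d0] show ?thesis using bracket_across_pairs[OF h] by simp
  qed
  have pair: "bracket x1 y1 + bracket x2 y2 = 0"
    if h: "hyperbolic_pairs3 x1 y1 x2 y2 x3 y3" for x1 y1 x2 y2 x3 y3
  proof -
    note o = hyperbolic_pairs3_values[OF h]
    note h' = hyperbolic_pairs3_symmetries(3)[OF h]
    note hs = h hyperbolic_pairs3_symmetries(5)[OF h] h' hyperbolic_pairs3_symmetries(5)[OF h']
    have d: "d_omega x1 y1 x2 = 0" "d_omega x1 y1 y2 = 0"
        "d_omega x1 x2 y2 = 0" "d_omega y1 x2 y2 = 0"
      using hs[THEN d0] d_omega_cyclic[of x1 x2 y2] d_omega_cyclic[of y1 x2 y2] by metis+
    show ?thesis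
      using wedge_at_hyperbolic_pair[of x1 y1 x2 y2] by (simp add: o d add.commute)
  qed
  have "hyperbolic_pairs3 x1 y1 x3 y3 x2 y2" "hyperbolic_pairs3 x2 y2 x3 y3 x1 y1"
    using h hyperbolic_pairs3_symmetries by blast+
  with h have "bracket x1 y1 + bracket x2 y2 = 0" "bracket x1 y1 + bracket x3 y3 = 0"
      "bracket x2 y2 + bracket x3 y3 = 0"
    using pair by blast+
  moreover have "bracket x1 y1 + bracket x1 y1 = (bracket x1 y1 + bracket x2 y2)
      + (bracket x1 y1 + bracket x3 y3) - (bracket x2 y2 + bracket x3 y3)"
    by (simp add: algebra_simps)
  ultimately have "bracket x1 y1 + bracket x1 y1 = 0" by (simp only: add_0 diff_zero)
  hence "bracket x1 y1 = 0" by (simp add: double_eq_0_vector)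
  moreover have "bracket x1 x2 = 0" using across[OF h] .
  moreover have "bracket y1 x2 = 0" using across hyperbolic_pairs3_symmetries(5)[OF h] by blast
  ultimately have "omega x1 y1 *s x2 + omega x2 x1 *s y1 + omega y1 x2 *s x1 = 0"
    using omega_jacobi[of x1 y1 x2] anticommute[of x2 x1] by (simp add: bracket_bilinear)
  hence "omega (omega x1 y1 *s x2 + omega x2 x1 *s y1 + omega y1 x2 *s x1) y2 = 0"
    by (simp add: omega_bilinear)
  thus False
    using h by (simp add: omega_bilinear hyperbolic_pairs3_def hyperbolic_pairs2_def)
qed

section \<open>Forms of rank four\<close>

definition omega_kernel :: "'v set" where
  "omega_kernel = {x. \<forall>y. omega x y = 0}"

lemma omega_kernelD:
  assumes "x \<in> omega_kernel"
  shows "omega x y = 0" "omega y x = 0"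
  using assms omega_skew[of y x] by (simp_all add: omega_kernel_def)

lemma subspace_omega_kernel: "subspace omega_kernel"
  by (simp add: subspace_def omega_kernel_def omega_bilinear)

text \<open>Put \<open>q(a,b) = \<omega>([a,s],b)\<close>. The wedge identity at the pair \<open>z, t\<close> expresses \<open>[x,s]\<close> through values
of \<open>d\<omega>\<close>, and these are differences of values of \<open>q\<close>, because \<open>s\<close> lies in the kernel. This gives
\<open>q(z,x) = 2 q(x,z)\<close> and, since \<open>q(t,z) = - q(z,t)\<close>, also \<open>q(x,y) = 2 q(z,t)\<close>. Both relations
hold with the two pairs exchanged as well, so every value equals 4 times itself, and 3 is invertible.\<close>

lemma kernel_bracket_two_pairs:
  assumes h: "hyperbolic_pairs2 x y z t" and s: "s \<in> omega_kernel"
  shows "omega (bracket x s) x = 0" "omega (bracket x s) z = 0" "omega (bracket x s) y = 0"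
proof -
  note k = omega_kernelD[OF s]
  have eq: "bracket x s
      = d_omega z t x *s s - d_omega z t s *s x + d_omega z x s *s t - d_omega t x s *s z"
    if h: "hyperbolic_pairs2 x y z t" for x y z t
    using wedge_at_hyperbolic_pair[of z t x s] hyperbolic_pairs2_values[OF h] k by simp
  have d: "d_omega a b s = omega (bracket b s) a - omega (bracket a s) b" for a b
    by (simp add: d_omega_def k anticommute[of s a] omega_bilinear)
  have q0: "omega (bracket x s) x = 0" and qz: "omega (bracket x s) z = - d_omega z x s"
    and qy: "omega (bracket x s) y = - d_omega z t s"
    if h: "hyperbolic_pairs2 x y z t" for x y z t
    by (simp_all add: eq[OF h] omega_bilinear k omega_self
        hyperbolic_pairs2_values[OF h])
  show "omega (bracket x s) x = 0" by (rule q0[OF h])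
  have h': "hyperbolic_pairs2 z t x y" by (rule hyperbolic_pairs2_symmetries(1)[OF h])
  have "3 * omega (bracket x s) z = 0"
    using qz[OF h] qz[OF h'] unfolding d by algebra
  thus "omega (bracket x s) z = 0" using three_nonzero by simp
  have m: "omega (bracket y s) x = - omega (bracket x s) y" if h: "hyperbolic_pairs2 x y z t" for x y z t
    using qy[OF hyperbolic_pairs2_symmetries(2)[OF h]] qy[OF h] by (simp add: omega_bilinear)
  have "3 * omega (bracket x s) y = 0"
    using qy[OF h] qy[OF h'] m[OF h] m[OF h'] unfolding d by algebra
  thus "omega (bracket x s) y = 0" using three_nonzero by simp
qed

text \<open>By the preceding lemma the kernel is an ideal, and the wedge identity at one pair then shows that it
is abelian.\<close>

lemma semisimple_kernel_trivial_two_pairs: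
  assumes "semisimple" and h: "hyperbolic_pairs2 x y z t"
    and span: "\<And>w. omega w x = 0 \<Longrightarrow> omega w y = 0 \<Longrightarrow> omega w z = 0 \<Longrightarrow> omega w t = 0 \<Longrightarrow>
      w \<in> omega_kernel"
  shows "omega_kernel = {0}"
proof -
  note syms = hyperbolic_pairs2_symmetries
  have hs: "hyperbolic_pairs2 x y z t" "hyperbolic_pairs2 y (-x) z t"
    "hyperbolic_pairs2 z t x y" "hyperbolic_pairs2 t (-z) x y"
    "hyperbolic_pairs2 x y t (-z)" "hyperbolic_pairs2 y (-x) t (-z)"
    "hyperbolic_pairs2 z t y (-x)" "hyperbolic_pairs2 t (-z) y (-x)"
    using h syms by blast+
  have on_basis: "omega (bracket a s) b = 0"
    if s: "s \<in> omega_kernel" and "a \<in> {x, y, z, t}" "b \<in> {x, y, z, t}" for a b s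
    using that(2,3) hs[THEN kernel_bracket_two_pairs(1), OF s]
      hs[THEN kernel_bracket_two_pairs(2), OF s] hs[THEN kernel_bracket_two_pairs(3), OF s]
    by (auto simp: omega_bilinear)
  have comm: "bracket s s' = 0" if s: "s \<in> omega_kernel" and s': "s' \<in> omega_kernel" for s s'
  proof -
    note k = omega_kernelD[OF s] omega_kernelD[OF s']
    note o = hyperbolic_pairs2_values[OF h]
    have d: "d_omega x y r = 0" if "r \<in> omega_kernel" for r
      using on_basis[OF that, of x y] on_basis[OF that, of y x] anticommute[of r x]
        omega_kernelD[OF that]
      by (simp add: d_omega_def omega_bilinear)
    have "bracket s s' = d_omega x s s' *s y - d_omega y s s' *s x"
      using wedge_at_hyperbolic_pair[of x y s s'] by (simp add: o k d s s')
    moreover from this have "omega (bracket s s') x = - d_omega x s s'"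
        "omega (bracket s s') y = - d_omega y s s'"
      by (simp_all add: omega_bilinear o omega_self)
    hence "d_omega x s s' = 0" "d_omega y s s' = 0"
      by (simp_all add: d_omega_def k eq_minus_self_scalar)
    ultimately show ?thesis by simp
  qed
  have rest: "w - omega w y *s x + omega w x *s y - omega w t *s z + omega w z *s t \<in> omega_kernel"
    (is "?k w \<in> _") for w
    by (rule span) (simp_all add: hyperbolic_pairs2_values[OF h] omega_bilinear omega_self)
  have into: "omega (bracket w s) v = 0" if s: "s \<in> omega_kernel" for s w v
  proof -
    have dec: "\<exists>r\<in>omega_kernel. \<exists>a b c d. w = r + a *s x + b *s y + c *s z + d *s t" for w
      by (rule bexI[OF _ rest[of w]], rule exI[of _ "omega w y"], rule exI[of _ "- omega w x"],
          rule exI[of _ "omega w t"], rule exI[of _ "- omega w z"]) simp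
    obtain r a b c d where v: "r \<in> omega_kernel" "v = r + a *s x + b *s y + c *s z + d *s t"
      using dec[of v] by blast
    obtain r' a' b' c' d' where w: "r' \<in> omega_kernel"
        "w = r' + a' *s x + b' *s y + c' *s z + d' *s t"
      using dec[of w] by blast
    have "omega (bracket e s) v = 0" if "e \<in> {x, y, z, t}" for e
      using on_basis[OF s that] omega_kernelD(2)[OF v(1)] by (simp add: v(2) omega_bilinear)
    thus ?thesis
      using comm[OF w(1) s] by (simp add: w(2) omega_bilinear bracket_bilinear)
  qed
  show ?thesis
  proof (rule semisimple_metabelian_ideal[OF \<open>semisimple\<close>])
    have "bracket s w \<in> omega_kernel" if "s \<in> omega_kernel" for s w
      by (subst anticommute) (simp add: omega_kernel_def omega_bilinear into[OF that])
    thus "ideal omega_kernel"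
      unfolding ideal_def using subspace_omega_kernel by blast
  qed (simp add: comm bracket_bilinear)
qed
text \<open>A vector orthogonal to both pairs lies in the kernel, since otherwise it would belong to a third
hyperbolic pair.\<close>

lemma dim_le_4_two_pairs:
  assumes "semisimple" and h: "hyperbolic_pairs2 x y z t"
  shows "dim (UNIV :: 'v set) \<le> 4"
proof -
  note o = hyperbolic_pairs2_values[OF h]
  (* The projection to the orthogonal complement of the two pairs. *)
  let ?r = "\<lambda>w. w - omega w y *s x + omega w x *s y - omega w t *s z + omega w z *s t"
  have perp: "omega (?r w) x = 0" "omega (?r w) y = 0" "omega (?r w) z = 0" "omega (?r w) t = 0"
    for w
    by (simp_all add: o omega_bilinear omega_self)
  have kernelI: "u \<in> omega_kernel"
    if u: "omega u x = 0" "omega u y = 0" "omega u z = 0" "omega u t = 0" for u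
  proof -
    have "omega u v = 0" for v
    proof (rule ccontr)
      assume "omega u v \<noteq> 0"
      moreover have "omega u (?r v) = omega u v"
        by (simp add: omega_bilinear u)
      ultimately have uv: "omega u (?r v) \<noteq> 0" by simp
      have flip: "omega a b = 0" if "omega b a = 0" for a b
        using that omega_skew[of a b] by simp
      have "hyperbolic_pairs3 x y z t u ((1 / omega u (?r v)) *s ?r v)"
        unfolding hyperbolic_pairs3_def hyperbolic_pairs2_def
        using o u[THEN flip] perp[THEN flip] uv by (simp add: omega_bilinear(7,8))
      thus False using no_three_hyperbolic_pairs by blast
    qed
    thus ?thesis by (simp add: omega_kernel_def)
  qed
  have "omega_kernel = {0}"
    by (rule semisimple_kernel_trivial_two_pairs[OF assms kernelI])
  have "w \<in> span {x, y, z, t}" for w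
  proof -
    have "?r w = 0" using kernelI[OF perp] \<open>omega_kernel = {0}\<close> by blast
    hence "w = omega w y *s x - omega w x *s y + omega w t *s z - omega w z *s t"
      by (simp add: algebra_simps)
    moreover have "omega w y *s x - omega w x *s y + omega w t *s z - omega w z *s t
        \<in> span {x, y, z, t}"
      by (intro span_add span_diff span_scale span_base) simp_all
    ultimately show ?thesis by metis
  qed
  hence "dim (UNIV :: 'v set) \<le> card {x, y, z, t}" by (intro dim_le_card) auto
  also have "\<dots> \<le> 4" by (simp add: card_insert_if)
  finally show ?thesis .
qed

end

section \<open>Forms of rank two\<close>

text \<open>The form has rank two, and \<open>z, t\<close> span a complement of its kernel. The pair is a parameter of the
locale because the argument changes it: \<open>z\<close> is chosen later to span the image of a nilpotent action.\<close>

locale omega_lie_algebra_rank_two = omega_lie_algebra_char_not_2_3 scale bracket omega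
  for scale :: "'k::field \<Rightarrow> 'v::ab_group_add \<Rightarrow> 'v" (infixr "*s" 75)
    and bracket :: "'v \<Rightarrow> 'v \<Rightarrow> 'v"
    and omega :: "'v \<Rightarrow> 'v \<Rightarrow> 'k" +
  fixes z t :: 'v
  assumes omega_zt: "omega z t = 1"
    and omega_kernelI: "omega x z = 0 \<Longrightarrow> omega x t = 0 \<Longrightarrow> x \<in> omega_kernel"
begin

abbreviation K :: "'v set" where "K \<equiv> omega_kernel"

text \<open>Coordinates of \<open>ad x\<close> with respect to the decomposition of the algebra into \<open>\<langle>z\<rangle> + \<langle>t\<rangle> + K\<close>. In
\<open>zz\<close>, \<open>tz\<close>, \<open>zt\<close>, \<open>tt\<close> the first letter names the coordinate and the second one the argument, as
for matrix entries: \<open>tz x\<close> is the \<open>t\<close>-coordinate of \<open>[x,z]\<close>. The components in \<open>K\<close> of \<open>[x,z]\<close> and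
\<open>[x,t]\<close> are \<open>kz x\<close> and \<open>kt x\<close>. For \<open>x\<close> in \<open>K\<close>, \<open>tr x\<close> is the trace of the action on \<open>L/K\<close>.\<close>

definition zz :: "'v \<Rightarrow> 'k" where "zz x = omega (bracket x z) t"
definition tz :: "'v \<Rightarrow> 'k" where "tz x = - omega (bracket x z) z"
definition zt :: "'v \<Rightarrow> 'k" where "zt x = omega (bracket x t) t"
definition tt :: "'v \<Rightarrow> 'k" where "tt x = - omega (bracket x t) z"
definition tr :: "'v \<Rightarrow> 'k" where "tr x = zz x + tt x"
definition kz :: "'v \<Rightarrow> 'v" where "kz x = bracket x z - zz x *s z - tz x *s t"
definition kt :: "'v \<Rightarrow> 'v" where "kt x = bracket x t - zt x *s z - tt x *s t"

lemma bracket_z: "bracket x z = zz x *s z + tz x *s t + kz x"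
  and bracket_t: "bracket x t = zt x *s z + tt x *s t + kt x"
  by (simp_all add: kz_def kt_def)

lemma omega_tz: "omega t z = - 1"
  using omega_skew[of t z] by (simp add: omega_zt)

lemma kz_in_K: "kz x \<in> K" and kt_in_K: "kt x \<in> K"
  by (rule omega_kernelI;
      simp add: kz_def kt_def omega_bilinear omega_zt omega_tz omega_self zz_def tz_def zt_def tt_def)+

lemma coefficient_linear:
  "zz (x + y) = zz x + zz y" "zz (x - y) = zz x - zz y" "zz (c *s x) = c * zz x"
  "zz (- x) = - zz x" "zz 0 = 0"
  "tz (x + y) = tz x + tz y" "tz (x - y) = tz x - tz y" "tz (c *s x) = c * tz x"
  "tz (- x) = - tz x" "tz 0 = 0"
  "zt (x + y) = zt x + zt y" "zt (x - y) = zt x - zt y" "zt (c *s x) = c * zt x"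
  "zt (- x) = - zt x" "zt 0 = 0"
  "tt (x + y) = tt x + tt y" "tt (x - y) = tt x - tt y" "tt (c *s x) = c * tt x"
  "tt (- x) = - tt x" "tt 0 = 0"
  "tr (x + y) = tr x + tr y" "tr (x - y) = tr x - tr y" "tr (c *s x) = c * tr x"
  "tr (- x) = - tr x" "tr 0 = 0"
  by (simp_all add: zz_def tz_def zt_def tt_def tr_def bracket_bilinear omega_bilinear algebra_simps)

lemma K_closed:
  "x \<in> K \<Longrightarrow> y \<in> K \<Longrightarrow> x + y \<in> K" "x \<in> K \<Longrightarrow> y \<in> K \<Longrightarrow> x - y \<in> K"
  "x \<in> K \<Longrightarrow> c *s x \<in> K" "x \<in> K \<Longrightarrow> - x \<in> K" "0 \<in> K"
  using subspace_omega_kernel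
  by (auto intro: subspace_add subspace_diff subspace_scale subspace_neg subspace_0)

lemma K_decomposition: "\<exists>k\<in>K. v = k + omega v t *s z - omega v z *s t"
  by (rule bexI[of _ "v - omega v t *s z + omega v z *s t"], simp, rule omega_kernelI)
    (simp_all add: omega_bilinear omega_zt omega_tz omega_self)

lemma K_independent:
  assumes "k \<in> K" and "a *s z + b *s t + k = 0"
  shows "a = 0" "b = 0" "k = 0"
proof -
  have "omega (a *s z + b *s t + k) t = 0" "omega (a *s z + b *s t + k) z = 0"
    using assms(2) by (simp_all add: omega_bilinear)
  thus "a = 0" "b = 0"
    by (simp_all add: omega_bilinear omega_self omega_zt omega_tz omega_kernelD[OF assms(1)])
  with assms(2) show "k = 0" by simp
qed

text \<open>The wedge identity at \<open>z, t\<close> gives this up to the multiples \<open>\<omega>([x,y],z) t\<close> and \<open>\<omega>([x,y],t) z\<close>.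
Comparing the coordinates of both sides shows that these are equal to their own negatives.\<close>

lemma bracket_K:
  assumes x: "x \<in> K" and y: "y \<in> K"
  shows "bracket x y = tr x *s y - tr y *s x"
proof -
  note k = omega_kernelD[OF x] omega_kernelD[OF y]
  have d: "d_omega z t v = tr v" if "v \<in> K" for v
    using omega_kernelD[OF that] anticommute[of t v]
    by (simp add: d_omega_def tr_def zz_def tt_def omega_bilinear)
  have eq: "bracket x y = tr x *s y - tr y *s x + d_omega z x y *s t - d_omega t x y *s z"
    using wedge_at_hyperbolic_pair[of z t x y] by (simp add: omega_zt k d x y)
  hence "omega (bracket x y) z = - d_omega z x y" "omega (bracket x y) t = - d_omega t x y"
    by (simp_all add: omega_bilinear k omega_self omega_zt omega_tz)
  hence "d_omega z x y = 0" "d_omega t x y = 0"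
    by (simp_all add: d_omega_def k eq_minus_self_scalar)
  with eq show ?thesis by simp
qed

lemma tr_bracket_K:
  assumes "x \<in> K" "y \<in> K"
  shows "tr (bracket x y) = 0"
  by (simp add: bracket_K[OF assms] coefficient_linear mult.commute)

lemma bracket_K_in_K: "x \<in> K \<Longrightarrow> y \<in> K \<Longrightarrow> bracket x y \<in> K"
  by (simp add: bracket_K K_closed)

text \<open>Here the \<open>\<omega>\<close>-terms of the Jacobi identity vanish. The components along \<open>z\<close> and \<open>t\<close> say that \<open>L/K\<close>
is a module over the Lie algebra \<open>K\<close>; the component in \<open>K\<close> restricts the maps \<open>kz\<close> and \<open>kt\<close>.\<close>

lemma K_module_z:
  assumes x: "x \<in> K" and y: "y \<in> K"
  shows "(tr x + zz x) * zz y + tz x * zt y - (tr y + zz y) * zz x - tz y * zt x = 0"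
    and "(tr x + zz x) * tz y + tz x * tt y - (tr y + zz y) * tz x - tz y * tt x = 0"
    and "zz x *s kz y + tz x *s kt y - zz y *s kz x - tz y *s kt x
      - tr (kz x) *s y + tr (kz y) *s x = 0"
proof -
  have 0: "bracket (bracket x y) z + bracket (bracket z x) y + bracket (bracket y z) x = 0"
    using omega_jacobi[of x y z] by (simp add: omega_kernelD[OF x] omega_kernelD[OF y])
  have 1: "bracket (bracket x y) z = tr x *s bracket y z - tr y *s bracket x z"
    by (simp add: bracket_K[OF x y] bracket_bilinear)
  have 2: "bracket (bracket v z) w
      = - (zz v *s bracket w z) - tz v *s bracket w t + tr (kz v) *s w - tr w *s kz v"
    if "w \<in> K" for v w
    using anticommute[of z w] anticommute[of t w] bracket_K[OF kz_in_K that]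
    by (simp add: bracket_z[of v] bracket_bilinear)
  have 3: "bracket (bracket z x) y = - bracket (bracket x z) y"
    by (simp add: anticommute[of z x] bracket_bilinear)
  have
    "((tr x + zz x) * zz y + tz x * zt y - (tr y + zz y) * zz x - tz y * zt x) *s z
    + ((tr x + zz x) * tz y + tz x * tt y - (tr y + zz y) * tz x - tz y * tt x) *s t
    + (zz x *s kz y + tz x *s kt y - zz y *s kz x - tz y *s kt x
      - tr (kz x) *s y + tr (kz y) *s x) = 0"
    using 0 unfolding 1 3 2[OF x] 2[OF y]
    by (simp add: bracket_z bracket_t algebra_simps)
  note eqs = K_independent[OF _ this]
  show "(tr x + zz x) * zz y + tz x * zt y - (tr y + zz y) * zz x - tz y * zt x = 0"
    and "(tr x + zz x) * tz y + tz x * tt y - (tr y + zz y) * tz x - tz y * tt x = 0"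
    and "zz x *s kz y + tz x *s kt y - zz y *s kz x - tz y *s kt x
      - tr (kz x) *s y + tr (kz y) *s x = 0"
    by (rule eqs; simp add: K_closed kz_in_K kt_in_K x y)+
qed

lemma K_module_t:
  assumes x: "x \<in> K" and y: "y \<in> K"
  shows "(tr x + tt x) * zt y + zt x * zz y - (tr y + tt y) * zt x - zt y * zz x = 0"
    and "(tr x + tt x) * tt y + zt x * tz y - (tr y + tt y) * tt x - zt y * tz x = 0"
    and "zt x *s kz y + tt x *s kt y - zt y *s kz x - tt y *s kt x
      - tr (kt x) *s y + tr (kt y) *s x = 0"
proof -
  have 0: "bracket (bracket x y) t + bracket (bracket t x) y + bracket (bracket y t) x = 0"
    using omega_jacobi[of x y t] by (simp add: omega_kernelD[OF x] omega_kernelD[OF y])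
  have 1: "bracket (bracket x y) t = tr x *s bracket y t - tr y *s bracket x t"
    by (simp add: bracket_K[OF x y] bracket_bilinear)
  have 2: "bracket (bracket v t) w
      = - (zt v *s bracket w z) - tt v *s bracket w t + tr (kt v) *s w - tr w *s kt v"
    if "w \<in> K" for v w
    using anticommute[of z w] anticommute[of t w] bracket_K[OF kt_in_K that]
    by (simp add: bracket_t[of v] bracket_bilinear)
  have 3: "bracket (bracket t x) y = - bracket (bracket x t) y"
    by (simp add: anticommute[of t x] bracket_bilinear)
  have
    "((tr x + tt x) * zt y + zt x * zz y - (tr y + tt y) * zt x - zt y * zz x) *s z
    + ((tr x + tt x) * tt y + zt x * tz y - (tr y + tt y) * tt x - zt y * tz x) *s t
    + (zt x *s kz y + tt x *s kt y - zt y *s kz x - tt y *s kt x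
      - tr (kt x) *s y + tr (kt y) *s x) = 0"
    using 0 unfolding 1 3 2[OF x] 2[OF y]
    by (simp add: bracket_z bracket_t algebra_simps)
  note eqs = K_independent[OF _ this]
  show "(tr x + tt x) * zt y + zt x * zz y - (tr y + tt y) * zt x - zt y * zz x = 0"
    and "(tr x + tt x) * tt y + zt x * tz y - (tr y + tt y) * tt x - zt y * tz x = 0"
    and "zt x *s kz y + tt x *s kt y - zt y *s kz x - tt y *s kt x
      - tr (kt x) *s y + tr (kt y) *s x = 0"
    by (rule eqs; simp add: K_closed kz_in_K kt_in_K x y)+
qed

lemma K_ideal_criterion:
  assumes sub: "subspace I" and "I \<subseteq> K"
    and closed: "\<And>x k. x \<in> I \<Longrightarrow> k \<in> K \<Longrightarrow> bracket x k \<in> I"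
      "\<And>x. x \<in> I \<Longrightarrow> bracket x z \<in> I" "\<And>x. x \<in> I \<Longrightarrow> bracket x t \<in> I"
  shows "ideal I"
  unfolding ideal_def
proof (intro conjI ballI allI)
  fix x v assume x: "x \<in> I"
  obtain k where k: "k \<in> K" "v = k + omega v t *s z - omega v z *s t"
    using K_decomposition by blast
  have "bracket x v = bracket x k + omega v t *s bracket x z - omega v z *s bracket x t"
    by (subst k(2)) (simp add: bracket_bilinear)
  thus "bracket x v \<in> I"
    using closed x k(1) sub by (simp add: subspace_add subspace_diff subspace_scale)
qed (rule sub)

section \<open>Triangular actions on the plane\<close>

text \<open>The \<open>\<omega>\<close>-Jacobi identity at \<open>x, z, t\<close>, whose right-hand side is \<open>x\<close>, for an action of \<open>K\<close> on \<open>L/K\<close>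
with image in the line spanned by \<open>z\<close>. The scalar \<open>tt z\<close>, the \<open>t\<close>-coordinate of \<open>[z,t]\<close>, measures
the failure of \<open>K + \<langle>z\<rangle>\<close> to be an ideal.\<close>

lemma bracket_z_t_relation:
  assumes tri: "\<And>k. k \<in> K \<Longrightarrow> tz k = 0" "\<And>k. k \<in> K \<Longrightarrow> tt k = 0" and x: "x \<in> K"
  shows "tt z * zz x = 0"
    and "zt (kz x) = zz (kt x) + tt z * zt x"
    and "kt (kz x) - kz (kt x) + zz (kt z) *s x - zt z *s kz x - tt z *s kt x = x"
proof -
  have tr: "tr k = zz k" if "k \<in> K" for k using tri(2)[OF that] by (simp add: tr_def)
  have "bracket (bracket x z) t + bracket (bracket t x) z + bracket (bracket z t) x = x"
    using omega_jacobi[of x z t] by (simp add: omega_kernelD[OF x] omega_zt)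
  moreover have "bracket (bracket x z) t
      = zz x *s (zt z *s z + tt z *s t + kt z) + zt (kz x) *s z + kt (kz x)"
    by (simp add: bracket_z[of x] tri x bracket_bilinear bracket_t[of z] bracket_t[of "kz x"] kz_in_K)
  moreover have "bracket (bracket t x) z = - (zz (kt x) *s z) - kz (kt x)"
    by (simp add: anticommute[of t x] bracket_t[of x] tri x bracket_bilinear bracket_z[of "kt x"]
        bracket_self kt_in_K)
  moreover have "bracket (bracket z t) x = - (zt z *s (zz x *s z + kz x))
      - tt z *s (zt x *s z + kt x) + zz (kt z) *s x - zz x *s kt z"
    using anticommute[of z x] anticommute[of t x] bracket_K[OF kt_in_K x, of z]
    by (simp add: bracket_t[of z] bracket_bilinear bracket_z[of x] bracket_t[of x] tri x
        tr kt_in_K scale_right_distrib scale_right_diff_distrib)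
  ultimately have "(zt (kz x) - zz (kt x) - tt z * zt x) *s z + (tt z * zz x) *s t
     + (kt (kz x) - kz (kt x) + zz (kt z) *s x - zt z *s kz x - tt z *s kt x - x) = 0"
    by (simp add: algebra_simps)
  note eqs = K_independent[OF _ this]
  have "zt (kz x) - zz (kt x) - tt z * zt x = 0" "tt z * zz x = 0"
    "kt (kz x) - kz (kt x) + zz (kt z) *s x - zt z *s kz x - tt z *s kt x - x = 0"
    by (rule eqs; simp add: K_closed kz_in_K kt_in_K x)+
  thus "tt z * zz x = 0"
    and "zt (kz x) = zz (kt x) + tt z * zt x"
    and "kt (kz x) - kz (kt x) + zz (kt z) *s x - zt z *s kz x - tt z *s kt x = x"
    by (simp_all add: algebra_simps)
qed

lemma z_nonzero: "z \<noteq> 0"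
  using omega_zt by (auto simp: omega_bilinear)

text \<open>The set of vectors orthogonal to \<open>z\<close> is \<open>K + \<langle>z\<rangle>\<close>.\<close>

lemma extension_by_z_ideal:
  assumes tri: "\<And>k. k \<in> K \<Longrightarrow> tz k = 0" "\<And>k. k \<in> K \<Longrightarrow> tt k = 0" and "tt z = 0"
  shows "ideal {w. omega w z = 0}"
  unfolding ideal_def
proof (intro conjI ballI allI)
  show "subspace {w. omega w z = 0}" by (simp add: subspace_def omega_bilinear)
  fix w v assume "w \<in> {w. omega w z = 0}"
  then obtain k c where w: "k \<in> K" "w = k + c *s z"
    using K_decomposition[of w] by auto
  obtain k' where v: "k' \<in> K" "v = k' + omega v t *s z - omega v z *s t"
    using K_decomposition by blast
  have "omega (bracket k z) z = 0" "omega (bracket k t) z = 0" "omega (bracket z t) z = 0"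
      "omega (bracket z k') z = 0"
    using tri[OF w(1)] tri[OF v(1)] \<open>tt z = 0\<close> anticommute[of z k']
    by (simp_all add: tz_def tt_def omega_bilinear)
  thus "bracket w v \<in> {w. omega w z = 0}"
    by (subst v(2)) (simp add: w(2) bracket_bilinear omega_bilinear bracket_self
        omega_kernelD[OF bracket_K_in_K[OF w(1) v(1)]])
qed

text \<open>Otherwise some \<open>e1\<close> in \<open>K\<close> has trace 1, and the first equation of \<open>bracket_z_t_relation\<close> shows that
\<open>K + \<langle>z\<rangle>\<close> is an ideal. It is metabelian: \<open>ad z\<close> is a scalar on the traceless part of \<open>K\<close>, so the
products lie in the sum of this part and the line of \<open>v = [e1,z]\<close>, and this sum is abelian.\<close>

lemma triangular_trace_zero:
  assumes "semisimple"
    and tri: "\<And>k. k \<in> K \<Longrightarrow> tz k = 0" "\<And>k. k \<in> K \<Longrightarrow> tt k = 0" and "e \<in> K"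
  shows "tr e = 0"
proof (rule ccontr)
  have tr: "tr k = zz k" if "k \<in> K" for k using tri(2)[OF that] by (simp add: tr_def)
  have bz: "bracket k z = tr k *s z + kz k" if "k \<in> K" for k
    using bracket_z[of k] tri(1)[OF that] tr[OF that] by simp
  assume "tr e \<noteq> 0"
  define e1 where "e1 = (1 / tr e) *s e"
  have e1: "e1 \<in> K" "tr e1 = 1"
    using \<open>e \<in> K\<close> \<open>tr e \<noteq> 0\<close> by (simp_all add: e1_def K_closed coefficient_linear)
  have "tt z = 0" using bracket_z_t_relation(1)[OF tri e1(1)] tr[OF e1(1)] e1(2) by simp
  define g where "g = tr (kz e1)"
  have kz: "kz y = g *s y" if y: "y \<in> K" "tr y = 0" for y
  proof -
    have eq: "kz y = g *s y - tr (kz y) *s e1"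
      using K_module_z(3)[OF e1(1) y(1)] e1 tr y tri by (simp add: g_def algebra_simps)
    (* tr e1 = 1, so taking traces leaves only the last term. *)
    from arg_cong[OF this, of tr] have "tr (kz y) = - tr (kz y)"
      using y e1(2) by (simp add: coefficient_linear)
    with eq show ?thesis by (simp add: eq_minus_self_scalar)
  qed
  define v where "v = z + kz e1"
  have zv: "bracket k z = g *s (k - tr k *s e1) + tr k *s v" if k: "k \<in> K" for k
  proof -
    have "kz (k - tr k *s e1) = g *s (k - tr k *s e1)"
      by (rule kz) (simp_all add: K_closed k e1 coefficient_linear)
    hence "bracket (k - tr k *s e1) z = g *s (k - tr k *s e1)"
      using bz[of "k - tr k *s e1"] by (simp add: K_closed k e1 coefficient_linear)
    moreover have "bracket e1 z = v" by (simp add: bz e1 v_def)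
    ultimately show ?thesis by (simp add: bracket_bilinear algebra_simps)
  qed
  have products: "\<exists>y c. y \<in> K \<and> tr y = 0 \<and> bracket a b = y + c *s v"
    if a: "omega a z = 0" and b: "omega b z = 0" for a b
  proof -
    obtain k c where k: "k \<in> K" "a = k + c *s z"
      using K_decomposition[of a] a by auto
    obtain k' c' where k': "k' \<in> K" "b = k' + c' *s z"
      using K_decomposition[of b] b by auto
    have "bracket a b = bracket k k' + c' *s bracket k z - c *s bracket k' z"
      by (simp add: k(2) k'(2) bracket_bilinear bracket_self anticommute[of z k'])
    also have "\<dots> = (bracket k k' + c' *s g *s (k - tr k *s e1) - c *s g *s (k' - tr k' *s e1))
        + (c' * tr k - c * tr k') *s v"
      unfolding zv[OF k(1)] zv[OF k'(1)] by (simp add: algebra_simps)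
    finally have "bracket a b = (bracket k k' + c' *s g *s (k - tr k *s e1)
        - c *s g *s (k' - tr k' *s e1)) + (c' * tr k - c * tr k') *s v" .
    moreover have "bracket k k' + c' *s g *s (k - tr k *s e1) - c *s g *s (k' - tr k' *s e1) \<in> K"
      by (simp add: K_closed k k' e1 bracket_K_in_K)
    moreover have "tr (bracket k k' + c' *s g *s (k - tr k *s e1) - c *s g *s (k' - tr k' *s e1)) = 0"
      by (simp add: coefficient_linear tr_bracket_K k k' e1)
    ultimately show ?thesis by blast
  qed
  have commute: "bracket (y + c *s v) (y' + c' *s v) = 0"
    if y: "y \<in> K" "tr y = 0" and y': "y' \<in> K" "tr y' = 0" for y y' c c'
  proof -
    have "bracket y v = 0" if y: "y \<in> K" "tr y = 0" for y
      using bracket_K[OF y(1) kz_in_K, of e1] zv[OF y(1)] y(2)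
      by (simp add: v_def bracket_bilinear g_def)
    moreover from this have "bracket v y' = 0"
      using y' anticommute[of v y'] by simp
    ultimately show ?thesis
      using y y' by (simp add: bracket_bilinear bracket_self bracket_K)
  qed
  have "{w. omega w z = 0} = {0}"
  proof (rule semisimple_metabelian_ideal[OF \<open>semisimple\<close> extension_by_z_ideal[OF tri \<open>tt z = 0\<close>]])
    fix a b c d
    assume "a \<in> {w. omega w z = 0}" "b \<in> {w. omega w z = 0}"
      "c \<in> {w. omega w z = 0}" "d \<in> {w. omega w z = 0}"
    thus "bracket (bracket a b) (bracket c d) = 0"
      using products[of a b] products[of c d] commute by auto
  qed
  thus False using omega_self[of z] z_nonzero by blast
qed

text \<open>Now \<open>K\<close> is abelian. If \<open>K + \<langle>z\<rangle>\<close> were an ideal, it would be metabelian with products in \<open>K\<close>. Hence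
\<open>tt z \<noteq> 0\<close>, and this makes the set of elements of \<open>K\<close> acting as zero on \<open>L/K\<close> an ideal. It is
abelian, hence zero, and it is the kernel of the linear form \<open>zt\<close> on \<open>K\<close>.\<close>

lemma triangular_kernel_small:
  assumes "semisimple"
    and tri: "\<And>k. k \<in> K \<Longrightarrow> tz k = 0" "\<And>k. k \<in> K \<Longrightarrow> tt k = 0"
  shows "\<exists>a. K \<subseteq> span {a}"
proof -
  have tr: "tr k = 0" if "k \<in> K" for k
    by (rule triangular_trace_zero[OF assms that])
  hence zz: "zz k = 0" if "k \<in> K" for k
    using tri(2)[OF that] that unfolding tr_def by force
  have comm: "bracket k k' = 0" if "k \<in> K" "k' \<in> K" for k k'
    using that by (simp add: bracket_K tr)
  have bz: "bracket k z = kz k" and bt: "bracket k t = zt k *s z + kt k" if "k \<in> K" for k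
    using bracket_z[of k] bracket_t[of k] that by (simp_all add: tri zz)
  have b: "tt z \<noteq> 0"
  proof
    assume "tt z = 0"
    have in_K: "bracket a b \<in> K" if a: "omega a z = 0" and b: "omega b z = 0" for a b
    proof -
      obtain k c where k: "k \<in> K" "a = k + c *s z"
        using K_decomposition[of a] a by auto
      obtain k' c' where k': "k' \<in> K" "b = k' + c' *s z"
        using K_decomposition[of b] b by auto
      have "bracket a b = c' *s kz k - c *s kz k'"
        using bz[OF k(1)] bz[OF k'(1)] anticommute[of z k'] comm[OF k(1) k'(1)]
        by (simp add: k(2) k'(2) bracket_bilinear bracket_self)
      thus ?thesis by (simp add: K_closed kz_in_K)
    qed
    have "{w. omega w z = 0} = {0}"
      by (rule semisimple_metabelian_ideal[OF \<open>semisimple\<close> extension_by_z_ideal[OF tri \<open>tt z = 0\<close>]])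
        (use in_K comm in auto)
    thus False using omega_self[of z] z_nonzero by blast
  qed
  have zt_kz: "zt (kz k) = tt z * zt k" if "k \<in> K" for k
    using bracket_z_t_relation(2)[OF tri that] zz[OF kt_in_K] by simp
  have kz_zt: "zt x *s kz y = zt y *s kz x" if "x \<in> K" "y \<in> K" for x y
    using K_module_t(3)[OF that] that by (simp add: tri tr kt_in_K)
  let ?N = "{k \<in> K. zt k = 0}"
  have zt_kt: "zt (kt y) = 0" if y: "y \<in> ?N" for y
  proof (cases "\<exists>x\<in>K. zt x \<noteq> 0")
    case True
    then obtain x where x: "x \<in> K" "zt x \<noteq> 0" by blast
    have kz_y: "kz y = 0" using kz_zt[OF x(1), of y] x(2) y by simp
    have "zt x *s kz (kt y) = zt (kt y) *s kz x" using kz_zt[OF x(1) kt_in_K] .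
    from arg_cong[OF this, of zt] have "zt (kz (kt y)) = tt z * zt (kt y)"
      using x zt_kz[OF x(1)] by (simp add: coefficient_linear mult.left_commute)
    moreover have "- kz (kt y) - tt z *s kt y = y"
      using bracket_z_t_relation(3)[OF tri, of y] y
      by (simp add: kz_y kt_def[of 0] coefficient_linear bracket_bilinear zz kt_in_K)
    from arg_cong[OF this, of zt] have "zt (kz (kt y)) + tt z * zt (kt y) = 0"
      using y by (simp add: coefficient_linear) (metis add.commute neg_eq_iff_add_eq_0)
    ultimately have "tt z * zt (kt y) + tt z * zt (kt y) = 0" by simp
    thus ?thesis using b by (simp only: double_eq_0_scalar mult_eq_0_iff simp_thms)
  qed (use kt_in_K in blast)
  have "?N = {0}"
  proof (rule semisimple_metabelian_ideal[OF \<open>semisimple\<close>])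
    show "ideal ?N"
    proof (rule K_ideal_criterion)
      show "subspace ?N"
        by (simp add: subspace_def K_closed coefficient_linear)
      show "bracket x z \<in> ?N" if "x \<in> ?N" for x
        using that by (simp add: bz kz_in_K zt_kz)
      show "bracket x t \<in> ?N" if "x \<in> ?N" for x
        using that zt_kt[OF that] by (simp add: bt kt_in_K)
    qed (auto simp: comm K_closed coefficient_linear)
  qed (auto simp: comm bracket_bilinear)
  show ?thesis
  proof (cases "\<exists>x\<in>K. zt x \<noteq> 0")
    case True
    then obtain x where x: "x \<in> K" "zt x \<noteq> 0" by blast
    have "y \<in> span {x}" if y: "y \<in> K" for y
    proof -
      have "y - (zt y / zt x) *s x \<in> ?N"
        using x y by (simp add: K_closed coefficient_linear)
      hence "y = (zt y / zt x) *s x" using \<open>?N = {0}\<close> by auto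
      thus ?thesis by (metis span_base span_scale singletonI)
    qed
    thus ?thesis by blast
  next
    case False
    hence "K \<subseteq> {0}" using \<open>?N = {0}\<close> by blast
    hence "K \<subseteq> span {0}" by (auto simp: span_zero)
    thus ?thesis by blast
  qed
qed

section \<open>The kernel of a form of rank two\<close>

lemma change_of_pair:
  assumes "b \<noteq> 0"
  shows "omega_lie_algebra_rank_two scale bracket omega (a *s z + b *s t) ((- 1 / b) *s z)"
proof unfold_locales
  show "omega (a *s z + b *s t) ((- 1 / b) *s z) = 1"
    using assms by (simp add: omega_bilinear omega_self omega_tz)
  fix x assume "omega x (a *s z + b *s t) = 0" "omega x ((- 1 / b) *s z) = 0"
  thus "x \<in> omega_kernel"
    using assms by (intro omega_kernelI) (simp_all add: omega_bilinear)
qed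

text \<open>The hypotheses on \<open>k\<close> say that its action on \<open>L/K\<close> has image in the line of \<open>a z + b t\<close>. So the action
is triangular with respect to a hyperbolic pair that starts with \<open>a z + b t\<close>.\<close>

lemma line_image_kernel_small:
  assumes "semisimple" and "a \<noteq> 0 \<or> b \<noteq> 0"
    and line: "\<And>k. k \<in> K \<Longrightarrow> zz k * b = tz k * a" "\<And>k. k \<in> K \<Longrightarrow> zt k * b = tt k * a"
  shows "\<exists>c. K \<subseteq> span {c}"
proof (cases "b = 0")
  case True
  with assms(2) line have "tz k = 0" "tt k = 0" if "k \<in> K" for k
    using that by fastforce+
  thus ?thesis by (rule triangular_kernel_small[OF \<open>semisimple\<close>])
next
  case False
  let ?z = "a *s z + b *s t" and ?t = "(- 1 / b) *s z"
  interpret new: omega_lie_algebra_rank_two scale bracket omega ?z ?t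
    by (rule change_of_pair[OF False])
  have im: "omega (bracket k z) ?z = 0" "omega (bracket k t) ?z = 0" if k: "k \<in> K" for k
    using line[OF k]
    by (simp_all add: bracket_z bracket_t omega_bilinear omega_self omega_zt omega_tz
        omega_kernelD[OF kz_in_K] omega_kernelD[OF kt_in_K] mult.commute)
  have im': "omega (bracket k (c *s z + d *s t)) ?z = 0" if "k \<in> K" for k c d
    by (simp only: bracket_bilinear omega_bilinear(1,7) im[OF that] mult_zero_right add_0)
  show ?thesis
  proof (rule new.triangular_kernel_small[OF \<open>semisimple\<close>])
    fix k assume "k \<in> K"
    show "new.tz k = 0" "new.tt k = 0"
      using im'[OF \<open>k \<in> K\<close>, of a b] im'[OF \<open>k \<in> K\<close>, of "- 1 / b" 0]
      by (simp_all only: new.tz_def new.tt_def scale_zero_left add_0_right minus_zero)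
  qed
qed

text \<open>Elements of trace zero in \<open>K\<close> commute, and the three equations say that the cross product of their
coordinate vectors in \<open>sl\<^sub>2\<close>, which represents the commutator, is zero.\<close>

lemma traceless_pair_parallel:
  assumes x: "x \<in> K" "tr x = 0" and y: "y \<in> K" "tr y = 0"
  shows "zz y * tz x = tz y * zz x" "zt y * tz x = tz y * zt x" "zz y * zt x = zt y * zz x"
proof -
  have tt: "tt x = - zz x" "tt y = - zz y"
    using x(2) y(2) by (simp_all add: tr_def eq_neg_iff_add_eq_0 add.commute)
  show "zt y * tz x = tz y * zt x"
    using K_module_z(1)[OF x(1) y(1)] x(2) y(2) by (simp add: algebra_simps)
  have "2 * (zz y * tz x - tz y * zz x) = 0"
    using K_module_z(2)[OF x(1) y(1)] x(2) y(2) tt by algebra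
  thus "zz y * tz x = tz y * zz x" using two_nonzero by simp
  have "2 * (zz y * zt x - zt y * zz x) = 0"
    using K_module_t(1)[OF x(1) y(1)] x(2) y(2) tt by algebra
  thus "zz y * zt x = zt y * zz x" using two_nonzero by simp
qed

text \<open>All elements of \<open>K\<close> act by multiples of the matrix \<open>X\<close> of one of them, and \<open>X\<^sup>2\<close> is the scalar
\<open>?D\<close>. If it is zero, \<open>X\<close> is nilpotent. Otherwise \<open>X\<close> is invertible, and the \<open>K\<close>-components of
\<open>K_module_z\<close> and \<open>K_module_t\<close> make the elements that act as zero central.\<close>

lemma traceless_kernel_small:
  assumes "semisimple" and tr: "\<And>k. k \<in> K \<Longrightarrow> tr k = 0"
  shows "\<exists>a. K \<subseteq> span {a}"
proof (cases "\<exists>x\<in>K. tz x \<noteq> 0 \<or> zt x \<noteq> 0 \<or> zz x \<noteq> 0")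
  case False
  thus ?thesis using triangular_kernel_small[OF \<open>semisimple\<close>] tr unfolding tr_def by auto
next
  case True
  then obtain x where x: "x \<in> K" and nz: "tz x \<noteq> 0 \<or> zt x \<noteq> 0 \<or> zz x \<noteq> 0" by blast
  have tt: "tt k = - zz k" if "k \<in> K" for k
    using tr[OF that] by (simp add: tr_def eq_neg_iff_add_eq_0 add.commute)
  note par = traceless_pair_parallel[OF x tr[OF x] _ tr]
  let ?D = "zz x * zz x + tz x * zt x"
  show ?thesis
  proof (cases "?D = 0")
    case nil: True
    show ?thesis
    proof (cases "tz x = 0")
      case True
      have "zz x = 0" "zt x \<noteq> 0" using nil nz True by auto
      hence "tz k = 0" "tt k = 0" if "k \<in> K" for k
        using par(2,3)[OF that that] True tt[OF that] by auto
      thus ?thesis by (rule triangular_kernel_small[OF \<open>semisimple\<close>])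
    next
      case False
      show ?thesis
      proof (rule line_image_kernel_small[OF \<open>semisimple\<close>])
        show "zz x \<noteq> 0 \<or> tz x \<noteq> 0" using False ..
        fix k assume k: "k \<in> K"
        show "zz k * tz x = tz k * zz x" by (rule par(1)[OF k k])
        have "tz x * (zt k * tz x + zz k * zz x) = 0"
          using par(1,2)[OF k k] nil by algebra
        thus "zt k * tz x = tt k * zz x"
          using False by (simp add: tt[OF k] eq_neg_iff_add_eq_0)
      qed
    qed
  next
    case False
    let ?N = "{k \<in> K. zz k = 0 \<and> tz k = 0 \<and> zt k = 0}"
    have central: "bracket y z = 0" "bracket y t = 0" if "y \<in> ?N" for y
    proof -
      have y: "y \<in> K" "zz y = 0" "tz y = 0" "zt y = 0" "tt y = 0" using that tt by auto
      have 1: "zz x *s kz y + tz x *s kt y = 0"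
        using K_module_z(3)[OF x y(1)] by (simp add: y tr kz_in_K)
      have 2: "zt x *s kz y - zz x *s kt y = 0"
        using K_module_t(3)[OF x y(1)] by (simp add: y tr kt_in_K tt[OF x])
      have "?D *s kz y = zz x *s (zz x *s kz y + tz x *s kt y) + tz x *s (zt x *s kz y - zz x *s kt y)"
        "?D *s kt y = zt x *s (zz x *s kz y + tz x *s kt y) - zz x *s (zt x *s kz y - zz x *s kt y)"
        by (simp_all add: algebra_simps)
      hence "?D *s kz y = 0" "?D *s kt y = 0" unfolding 1 2 by simp_all
      hence "kz y = 0" "kt y = 0" using False by simp_all
      thus "bracket y z = 0" "bracket y t = 0" by (simp_all add: bracket_z bracket_t y)
    qed
    have comm: "bracket k k' = 0" if "k \<in> K" "k' \<in> K" for k k'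
      using that by (simp add: bracket_K tr)
    have "?N = {0}"
    proof (rule semisimple_metabelian_ideal[OF \<open>semisimple\<close>])
      show "ideal ?N"
      proof (rule K_ideal_criterion)
        show "subspace ?N" by (simp add: subspace_def K_closed coefficient_linear)
      qed (auto simp: comm K_closed coefficient_linear central)
    qed (auto simp: comm bracket_bilinear)
    have "y \<in> span {x}" if y: "y \<in> K" for y
    proof -
      (* Half the trace of the product of the two actions; it equals ?D for y = x. *)
      let ?c = "zz x * zz y + tz x * zt y"
      have "?D *s y - ?c *s x \<in> ?N"
        using par[OF y y] by (simp add: K_closed x y coefficient_linear) algebra
      hence "?D *s y = ?c *s x" using \<open>?N = {0}\<close> by auto
      hence "(1 / ?D) *s (?D *s y) = (1 / ?D) *s (?c *s x)" by simp
      hence "y = (?c / ?D) *s x" using False by simp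
      thus ?thesis by (metis span_base span_scale singletonI)
    qed
    thus ?thesis by blast
  qed
qed

text \<open>The traceless part of \<open>K\<close> is abelian, and it is an ideal unless \<open>kz\<close> or \<open>kt\<close> leads out of it. In
that case its elements are proportional, by the \<open>K\<close>-components of \<open>K_module_z\<close> and \<open>K_module_t\<close>.\<close>

lemma traceless_part_trivial_kernel_small:
  assumes "semisimple" and e: "e \<in> K" "tr e = 1"
    and trivial: "\<And>k. k \<in> K \<Longrightarrow> tr k = 0 \<Longrightarrow> zz k = 0 \<and> tz k = 0 \<and> zt k = 0"
  shows "\<exists>a b. K \<subseteq> span {a, b}"
proof -
  let ?N = "{k \<in> K. tr k = 0}"
  have N: "zz k = 0" "tz k = 0" "zt k = 0" "tt k = 0" if "k \<in> K" "tr k = 0" for k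
    using trivial[OF that] that(2) by (auto simp: tr_def)
  have proportional: "tr (kz x) *s y = tr (kz y) *s x" "tr (kt x) *s y = tr (kt y) *s x"
    if "x \<in> ?N" "y \<in> ?N" for x y
    using K_module_z(3)[of x y] K_module_t(3)[of x y] that by (simp_all add: N)
  have K_span: "K \<subseteq> span {x, e}" if "\<And>y. y \<in> ?N \<Longrightarrow> y \<in> span {x}" for x
  proof
    fix y assume "y \<in> K"
    hence "y - tr y *s e \<in> ?N" by (simp add: K_closed e coefficient_linear)
    hence "y - tr y *s e \<in> span {x}" by (rule that)
    thus "y \<in> span {x, e}" by (subst insert_commute) (auto simp: span_breakdown_eq)
  qed
  show ?thesis
  proof (cases "\<exists>x\<in>?N. tr (kz x) \<noteq> 0 \<or> tr (kt x) \<noteq> 0")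
    case True
    then obtain x where x: "x \<in> ?N" "tr (kz x) \<noteq> 0 \<or> tr (kt x) \<noteq> 0" by blast
    have "y \<in> span {x}" if y: "y \<in> ?N" for y
    proof -
      have scaled: "y \<in> span {x}" if "c *s y = d *s x" "c \<noteq> 0" for c d
      proof -
        have "(1 / c) *s (c *s y) = (1 / c) *s (d *s x)" using that by simp
        hence "y = (d / c) *s x" using that(2) by simp
        thus ?thesis by (metis span_base span_scale singletonI)
      qed
      show ?thesis using x(2) proportional[OF x(1) y] scaled by blast
    qed
    with K_span show ?thesis by blast
  next
    case False
    have "?N = {0}"
    proof (rule semisimple_metabelian_ideal[OF \<open>semisimple\<close>])
      show "ideal ?N"
      proof (rule K_ideal_criterion)
        show "subspace ?N" by (simp add: subspace_def K_closed coefficient_linear)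
      qed (use False in \<open>auto simp: bracket_K K_closed coefficient_linear bracket_z bracket_t N
          kz_in_K kt_in_K\<close>)
    qed (auto simp: bracket_K bracket_bilinear)
    have "K \<subseteq> span {0, e}"
      by (rule K_span) (simp only: \<open>?N = {0}\<close> singleton_iff span_zero)
    thus ?thesis by blast
  qed
qed

text \<open>Let \<open>x\<close> in \<open>K\<close> be traceless with action \<open>X \<noteq> 0\<close>, and let \<open>E\<close> be the action of \<open>e\<close>. From \<open>[e,x] = x\<close>
one gets \<open>EX - XE = X\<close>, hence \<open>EX\<^sup>2 - X\<^sup>2E = 2X\<^sup>2\<close>. As \<open>X\<^sup>2\<close> is a scalar matrix, it is zero. The
image of \<open>X\<close> is an eigenline of \<open>E\<close>, on which the eigenvalue exceeds that on the quotient by 1. As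
\<open>tr E = 1\<close>, the eigenvalues are 1 and 0, and the image of \<open>E\<close> is that of \<open>X\<close>. All traceless elements
of \<open>K\<close> act by multiples of \<open>X\<close>, so the action is triangular.\<close>

lemma nonzero_trace_kernel_small:
  assumes "semisimple" and e: "e \<in> K" "tr e = 1"
  shows "\<exists>a b. K \<subseteq> span {a, b}"
proof (cases "\<exists>x\<in>K. tr x = 0 \<and> (zz x \<noteq> 0 \<or> tz x \<noteq> 0 \<or> zt x \<noteq> 0)")
  case False
  thus ?thesis using traceless_part_trivial_kernel_small[OF assms] by blast
next
  case True
  then obtain x where x: "x \<in> K" "tr x = 0" and nz: "zz x \<noteq> 0 \<or> tz x \<noteq> 0 \<or> zt x \<noteq> 0" by blast
  have ttx: "tt x = - zz x" and tte: "tt e = 1 - zz e"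
    using x e by (auto simp: tr_def eq_neg_iff_add_eq_0 algebra_simps)
  (* The entries of the matrix equation E X - X E = X. *)
  have weight: "zz x = tz x * zt e - tz e * zt x"
      "tz x = 2 * (tz e * zz x) - (2 * zz e - 1) * tz x"
      "zt x = (2 * zz e - 1) * zt x - 2 * (zt e * zz x)"
    using K_module_z(1,2)[OF x(1) e(1)] K_module_t(1)[OF x(1) e(1)]
    unfolding ttx tte x(2) e(2) by algebra+
  have "2 * (zz x * zz x + tz x * zt x) = 0" using weight by algebra
  hence nil: "zz x * zz x + tz x * zt x = 0"
    using two_nonzero by (simp only: mult_eq_0_iff simp_thms)
  have split: "\<exists>y. y \<in> K \<and> tr y = 0 \<and> k = y + tr k *s e" if "k \<in> K" for k
    by (rule exI[of _ "k - tr k *s e"]) (simp add: that e K_closed coefficient_linear)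
  have on_e: "zz e * tz x = tz e * zz x"
  proof -
    have "2 * (zz e * tz x - tz e * zz x) = 0" using weight(2) by algebra
    thus ?thesis using two_nonzero by simp
  qed
  have coords: "\<exists>y c. y \<in> K \<and> tr y = 0 \<and> zz k = zz y + c * zz e \<and> tz k = tz y + c * tz e \<and>
      zt k = zt y + c * zt e \<and> tt k = - zz y + c * (1 - zz e)" if k: "k \<in> K" for k
  proof -
    obtain y c where y: "y \<in> K" "tr y = 0" and k: "k = y + c *s e" using split[OF k] by blast
    have "tt y = - zz y" using y(2) by (simp add: tr_def eq_neg_iff_add_eq_0 add.commute)
    with y show ?thesis
      by (intro exI[of _ y] exI[of _ c]) (simp add: k coefficient_linear tte)
  qed
  have "\<exists>a. K \<subseteq> span {a}"
  proof (cases "tz x = 0")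
    case True
    have z0: "zz x = 0" "zt x \<noteq> 0" using nil nz True by auto
    have "tz e = 0" using weight(1) z0 True by simp
    have "2 * ((1 - zz e) * zt x) = 0" using weight(3) z0 by algebra
    hence "1 - zz e = 0" using z0 two_nonzero by simp
    have "tz k = 0" "tt k = 0" if in_K: "k \<in> K" for k
    proof -
      obtain y c where y: "y \<in> K" "tr y = 0"
          and k: "tz k = tz y + c * tz e" "tt k = - zz y + c * (1 - zz e)"
        using coords[OF in_K] by blast
      have "tz y = 0" "zz y = 0" using traceless_pair_parallel(2,3)[OF x y] z0 True by auto
      thus "tz k = 0" "tt k = 0" by (simp_all add: k \<open>tz e = 0\<close> \<open>1 - zz e = 0\<close>)
    qed
    thus ?thesis by (rule triangular_kernel_small[OF \<open>semisimple\<close>])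
  next
    case False
    show ?thesis
    proof (rule line_image_kernel_small[OF \<open>semisimple\<close>])
      show "zz x \<noteq> 0 \<or> tz x \<noteq> 0" using False ..
      fix k assume "k \<in> K"
      then obtain y c where y: "y \<in> K" "tr y = 0"
          and k: "zz k = zz y + c * zz e" "tz k = tz y + c * tz e"
            "zt k = zt y + c * zt e" "tt k = - zz y + c * (1 - zz e)"
        using coords by blast
      note par = traceless_pair_parallel[OF x y]
      show "zz k * tz x = tz k * zz x"
        unfolding k using par(1) on_e by algebra
      have "tz x * (zt k * tz x - tt k * zz x) = 0"
        unfolding k using par(1,2) nil on_e weight(1) by algebra
      thus "zt k * tz x = tt k * zz x" using False by simp
    qed
  qed
  then obtain a where "K \<subseteq> span {a}" by blast
  hence "K \<subseteq> span {a, a}" by simp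
  thus ?thesis by blast
qed

lemma kernel_small:
  assumes "semisimple"
  shows "\<exists>a b. K \<subseteq> span {a, b}"
proof (cases "\<exists>e\<in>K. tr e \<noteq> 0")
  case True
  then obtain e where e: "e \<in> K" "tr e \<noteq> 0" by blast
  show ?thesis
    by (rule nonzero_trace_kernel_small[OF assms, of "(1 / tr e) *s e"])
      (simp_all add: e K_closed coefficient_linear)
next
  case False
  then obtain a where "K \<subseteq> span {a}" using traceless_kernel_small[OF assms] by blast
  hence "K \<subseteq> span {a, a}" by simp
  thus ?thesis by blast
qed

lemma dim_le_4_rank_two:
  assumes "semisimple"
  shows "dim (UNIV :: 'v set) \<le> 4"
proof -
  obtain a b where ab: "K \<subseteq> span {a, b}" using kernel_small[OF assms] by blast
  have "v \<in> span {z, t, a, b}" for v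
  proof -
    obtain k where k: "k \<in> K" "v = k + omega v t *s z - omega v z *s t"
      using K_decomposition by blast
    have "k \<in> span {z, t, a, b}" using k(1) ab span_mono[of "{a, b}" "{z, t, a, b}"] by blast
    thus ?thesis by (subst k(2)) (simp add: span_add span_diff span_scale span_base)
  qed
  hence "dim (UNIV :: 'v set) \<le> card {z, t, a, b}" by (intro dim_le_card) auto
  also have "\<dots> \<le> 4" by (simp add: card_insert_if)
  finally show ?thesis .
qed

end

section \<open>The dimension bound\<close>

context omega_lie_algebra_char_not_2_3
begin

theorem lie_or_dim_le_4:
  assumes "semisimple"
  shows "lie_algebra scale bracket \<or> dim (UNIV :: 'v set) \<le> 4"
proof (cases "\<forall>x y. omega x y = 0")
  case True
  hence "lie_algebra scale bracket"
    by unfold_locales (simp add: omega_jacobi)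
  thus ?thesis ..
next
  case False
  have normalize: "\<exists>y'. omega x y' = 1 \<and> (\<forall>a. omega a y = 0 \<longrightarrow> omega a y' = 0)"
    if "omega x y \<noteq> 0" for x y
    by (rule exI[of _ "(1 / omega x y) *s y"]) (simp add: omega_bilinear that)
  from False normalize obtain z t where zt: "omega z t = 1" by blast
  have tz: "omega t z = - 1" using omega_skew[of t z] zt by simp
  have "dim (UNIV :: 'v set) \<le> 4"
  proof (cases "\<forall>x. omega x z = 0 \<longrightarrow> omega x t = 0 \<longrightarrow> x \<in> omega_kernel")
    case True
    then interpret omega_lie_algebra_rank_two scale bracket omega z t
      by unfold_locales (use zt in auto)
    show ?thesis by (rule dim_le_4_rank_two[OF assms])
  next
    case False
    then obtain x y where x: "omega x z = 0" "omega x t = 0" and xy: "omega x y \<noteq> 0"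
      by (auto simp: omega_kernel_def)
    (* Projecting y off the pair z, t does not change its product with x. *)
    let ?y = "y - omega y t *s z + omega y z *s t"
    have "omega ?y z = 0" "omega ?y t = 0"
      by (simp_all add: omega_bilinear omega_self zt tz)
    hence y: "omega z ?y = 0" "omega t ?y = 0"
      using omega_skew[of z ?y] omega_skew[of t ?y] by simp_all
    have "omega x ?y \<noteq> 0" using x xy by (simp add: omega_bilinear)
    then obtain y' where y': "omega x y' = 1" "omega z y' = 0" "omega t y' = 0"
      using normalize y by blast
    have "hyperbolic_pairs2 z t x y'"
      using zt x y' omega_skew[of z x] omega_skew[of t x] by (simp add: hyperbolic_pairs2_def)
    thus ?thesis by (rule dim_le_4_two_pairs[OF assms])
  qed
  thus ?thesis ..
qed

end

theorem theorem2:
  fixes scale :: "'k::field \<Rightarrow> 'v::ab_group_add \<Rightarrow> 'v"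
    and bracket :: "'v \<Rightarrow> 'v \<Rightarrow> 'v"
    and omega :: "'v \<Rightarrow> 'v \<Rightarrow> 'k"
  assumes "CHAR('k) \<noteq> 2" and "CHAR('k) \<noteq> 3"
    and "omega_lie_algebra scale bracket omega"
    and "\<exists>B. finite_dimensional_vector_space scale B"
    and "anticomm_algebra.semisimple scale bracket"
  shows "lie_algebra scale bracket \<or> vector_space.dim scale (UNIV :: 'v set) \<le> 4"
proof -
  interpret omega_lie_algebra scale bracket omega by fact
  have "of_nat n \<noteq> (0::'k)" if n: "n = 2 \<or> n = 3" "CHAR('k) \<noteq> n" for n
  proof
    assume "of_nat n = (0::'k)"
    hence dvd: "CHAR('k) dvd n" by (simp add: of_nat_eq_0_iff_char_dvd)
    hence "CHAR('k) \<le> n" by (rule dvd_imp_le) (use n in auto)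
    moreover have "CHAR('k) \<noteq> 0" using dvd n by auto
    moreover have "CHAR('k) \<noteq> 1" by simp
    ultimately have "n = 3 \<and> CHAR('k) = 2" using n by linarith
    with dvd show False by simp
  qed
  from this[of 2] this[of 3] have "(2::'k) \<noteq> 0" "(3::'k) \<noteq> 0"
    using assms(1,2) by simp_all
  then interpret omega_lie_algebra_char_not_2_3 scale bracket omega
    by unfold_locales
  show ?thesis by (rule lie_or_dim_le_4) fact
qed

end
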